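(* Let $d\ge 1$ be an integer and let $\Pi$ be a nonzero non-negative Borel measure on $(0,\infty)$ (possibly infinite) with $\int_0^\infty (g+1)^{-d/2}\,\Pi(\mathrm{d}g)<\infty$. Let $X\sim N_d(\mu,I_d)$ with $\mu\in\mathbb{R}^d$ unknown, and consider the (generalized) Bayes estimator of $\mu$ under quadratic loss with respect to the prior density $\pi(\mu)=\int_0^\infty g^{-d/2}\exp\left(-\frac{\|\mu\|^2}{2g}\right)\Pi(\mathrm{d}g)$, namely $$\delta_\pi(x)=\left(1-\frac{\int_0^\infty(g+1)^{-d/2-1}\exp\left(-\frac{\|x\|^2}{2(g+1)}\right)\Pi(\mathrm{d}g)}{\int_0^\infty(g+1)^{-d/2}\exp\left(-\frac{\|x\|^2}{2(g+1)}\right)\Pi(\mathrm{d}g)}\right)x .$$ If $$\int_0^\infty\frac{\Pi(\mathrm{d}g)}{g+1}<\infty ,$$ then $\delta_\pi$ is admissible.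
   Context: An estimator is a measurable function $\delta:\mathbb{R}^d\to\mathbb{R}^d$. Its risk under quadratic loss is $R(\mu,\delta)=E_\mu\|\delta(X)-\mu\|^2$ with $X\sim N_d(\mu,I_d)$. The estimator $\delta$ is inadmissible if there is an estimator $\delta'$ with $R(\mu,\delta')\le R(\mu,\delta)$ for all $\mu\in\mathbb{R}^d$ and strict inequality for some $\mu$; otherwise it is admissible. *)

theory Defs
  imports "HOL-Probability.Probability"
begin

definition normal_vec_density :: "real ^ 'n \<Rightarrow> real ^ 'n \<Rightarrow> real" where
  "normal_vec_density \<mu> x =
     (2 * pi) powr (- real CARD('n) / 2) * exp (- (norm (x - \<mu>))\<^sup>2 / 2)"

text \<open>The distribution of a normal vector with mean \<open>\<mu>\<close> and identity covariance matrix.\<close>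

definition normal_vec :: "real ^ 'n \<Rightarrow> (real ^ 'n) measure" where
  "normal_vec \<mu> = density lborel (\<lambda>x. ennreal (normal_vec_density \<mu> x))"

definition estimator :: "(real ^ 'n \<Rightarrow> real ^ 'n) \<Rightarrow> bool" where
  "estimator \<delta> \<longleftrightarrow> \<delta> \<in> borel_measurable borel"

text \<open>The risk of an estimator may be infinite, so it takes values in \<^typ>\<open>ennreal\<close>.\<close>

definition risk :: "real ^ 'n \<Rightarrow> (real ^ 'n \<Rightarrow> real ^ 'n) \<Rightarrow> ennreal" where
  "risk \<mu> \<delta> = (\<integral>\<^sup>+ x. ennreal ((norm (\<delta> x - \<mu>))\<^sup>2) \<partial>normal_vec \<mu>)"

definition inadmissible :: "(real ^ 'n \<Rightarrow> real ^ 'n) \<Rightarrow> bool" where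
  "inadmissible \<delta> \<longleftrightarrow>
     (\<exists>\<delta>'. estimator \<delta>' \<and> (\<forall>\<mu>. risk \<mu> \<delta>' \<le> risk \<mu> \<delta>) \<and> (\<exists>\<mu>. risk \<mu> \<delta>' < risk \<mu> \<delta>))"

definition admissible :: "(real ^ 'n \<Rightarrow> real ^ 'n) \<Rightarrow> bool" where
  "admissible \<delta> \<longleftrightarrow> estimator \<delta> \<and> \<not> inadmissible \<delta>"

definition marginal_density :: "(real ^ 'n \<Rightarrow> ennreal) \<Rightarrow> real ^ 'n \<Rightarrow> ennreal" where
  "marginal_density \<pi> x = (\<integral>\<^sup>+ \<mu>. ennreal (normal_vec_density \<mu> x) * \<pi> \<mu> \<partial>lborel)"

definition posterior_loss :: "(real ^ 'n \<Rightarrow> ennreal) \<Rightarrow> real ^ 'n \<Rightarrow> real ^ 'n \<Rightarrow> ennreal" where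
  "posterior_loss \<pi> x a =
     (\<integral>\<^sup>+ \<mu>. ennreal ((norm (a - \<mu>))\<^sup>2) * (ennreal (normal_vec_density \<mu> x) * \<pi> \<mu>) \<partial>lborel)
       / marginal_density \<pi> x"

text \<open>
  A generalized Bayes estimator minimizes the posterior expected quadratic loss at every
  observation. The prior density \<open>\<pi>\<close> may have infinite total mass. The posterior must
  nevertheless be a probability distribution, whence the condition on the marginal density, and
  the minimum must be finite, since otherwise every action would be a minimizer.
\<close>

definition generalized_Bayes :: "(real ^ 'n \<Rightarrow> ennreal) \<Rightarrow> (real ^ 'n \<Rightarrow> real ^ 'n) \<Rightarrow> bool" where
  "generalized_Bayes \<pi> \<delta> \<longleftrightarrow> estimator \<delta> \<and>
     (\<forall>x. 0 < marginal_density \<pi> x \<and> marginal_density \<pi> x < \<infinity> \<and>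
          posterior_loss \<pi> x (\<delta> x) < \<infinity> \<and>
          (\<forall>a. posterior_loss \<pi> x (\<delta> x) \<le> posterior_loss \<pi> x a))"

text \<open>The density of a scale mixture of normals can be infinite at the origin.\<close>

definition mixture_prior :: "real measure \<Rightarrow> real ^ 'n \<Rightarrow> ennreal" where
  "mixture_prior \<nu> \<mu> =
     (\<integral>\<^sup>+ g. ennreal (g powr (- real CARD('n) / 2) * exp (- (norm \<mu>)\<^sup>2 / (2 * g))) \<partial>\<nu>)"

definition mixture_estimator :: "real measure \<Rightarrow> real ^ 'n \<Rightarrow> real ^ 'n" where
  "mixture_estimator \<nu> x =
     (1 - (LINT g|\<nu>. (g + 1) powr (- real CARD('n) / 2 - 1) * exp (- (norm x)\<^sup>2 / (2 * (g + 1))))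
        / (LINT g|\<nu>. (g + 1) powr (- real CARD('n) / 2) * exp (- (norm x)\<^sup>2 / (2 * (g + 1)))))
     *\<^sub>R x"

end

theory Submission
  imports Defs
begin

text \<open>
  Blyth's method, with the mixing measure restricted to \<open>g \<le> n\<close> as the sequence of proper priors.
  With \<open>w = 1 / (g + 1)\<close>, the posterior of \<open>g\<close> given \<open>x\<close> has density proportional to
  \<open>w powr (d / 2) * exp (- w * norm x ^ 2 / 2)\<close>, and the estimator is \<open>(1 - E[w | x]) x\<close>. The
  excess Bayes risk of the generalized Bayes estimator under the \<open>n\<close>-th prior is the integral of
  \<open>norm x ^ 2 * (E\<^sub>n[w | x] - E[w | x]) ^ 2 * m\<^sub>n x\<close>, where \<open>m\<^sub>n\<close> is the marginal density. By the
  Cauchy-Schwarz inequality the integrand is at most \<open>4 * norm x ^ 2 * E[w ^ 2 | x] * m x\<close>, whose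
  integral is a multiple of the integral of \<open>w\<close> against the mixing measure. So dominated
  convergence applies, and the excess tends to 0.

  If \<open>\<delta>'\<close> dominates \<open>\<delta>\<close>, the parallelogram identity shows that the midpoint of the two gains at
  least a quarter of their squared distance. This bounds the integral of
  \<open>norm (\<delta> x - \<delta>' x) ^ 2 * m\<^sub>n x / 4\<close> by the excess, hence \<open>\<delta>' = \<delta>\<close> almost everywhere. No
  continuity of the risk function is needed.
\<close>

section \<open>Gaussian integrals\<close>

text \<open>The density of N(b, \<sigma>^2 I). The product over the basis lets integrals factor into
  one-dimensional ones. \<sigma> is a standard deviation, hence the square roots wherever a variance
  is inserted.\<close>

definition isotropic_density :: "'a::euclidean_space \<Rightarrow> real \<Rightarrow> 'a \<Rightarrow> real" where
  "isotropic_density b \<sigma> x = (\<Prod>e\<in>Basis. normal_density (b \<bullet> e) \<sigma> (x \<bullet> e))"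

lemma isotropic_density_nonneg [simp]: "0 \<le> isotropic_density b \<sigma> x"
  by (simp add: isotropic_density_def prod_nonneg)

lemma isotropic_density_eq:
  fixes b x :: "'a::euclidean_space"
  assumes "\<sigma> > 0"
  shows "isotropic_density b \<sigma> x =
    (2 * pi * \<sigma>\<^sup>2) powr (- real DIM('a) / 2) * exp (- (norm (x - b))\<^sup>2 / (2 * \<sigma>\<^sup>2))"
proof -
  have "isotropic_density b \<sigma> x =
      (1 / sqrt (2 * pi * \<sigma>\<^sup>2)) ^ DIM('a) * exp (\<Sum>e\<in>Basis. - ((x - b) \<bullet> e)\<^sup>2 / (2 * \<sigma>\<^sup>2))"
    by (simp add: isotropic_density_def normal_density_def prod.distrib exp_sum inner_diff_left
        prod_dividef power_one_over del: real_sqrt_mult)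
  also have "(\<Sum>e\<in>Basis. - ((x - b) \<bullet> e)\<^sup>2 / (2 * \<sigma>\<^sup>2)) = - (norm (x - b))\<^sup>2 / (2 * \<sigma>\<^sup>2)"
    unfolding power2_norm_eq_inner euclidean_inner[of "x - b" "x - b"]
    by (simp add: sum_divide_distrib sum_negf power2_eq_square)
  also have "(1 / sqrt (2 * pi * \<sigma>\<^sup>2)) ^ DIM('a) = (2 * pi * \<sigma>\<^sup>2) powr (- real DIM('a) / 2)"
  proof -
    have "0 < 2 * pi * \<sigma>\<^sup>2" using assms by simp
    then have "1 / sqrt (2 * pi * \<sigma>\<^sup>2) = (2 * pi * \<sigma>\<^sup>2) powr (- 1 / 2)"
      by (simp add: powr_minus powr_half_sqrt field_simps del: real_sqrt_mult)
    then show ?thesis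
      using assms by (simp add: powr_power del: real_sqrt_mult)
  qed
  finally show ?thesis .
qed

section \<open>Gaussian moments in one and in several dimensions\<close>

lemma nn_integral_normal_density: "\<sigma> > 0 \<Longrightarrow> (\<integral>\<^sup>+t. ennreal (normal_density m \<sigma> t) \<partial>lborel) = 1"
  by (subst nn_integral_eq_integral) auto

text \<open>Bias-variance decomposition: the cross term is an odd central moment and
  vanishes.\<close>

lemma nn_integral_square_normal_density:
  assumes "\<sigma> > 0"
  shows "(\<integral>\<^sup>+t. ennreal ((a - t)\<^sup>2 * normal_density m \<sigma> t) \<partial>lborel) = ennreal ((a - m)\<^sup>2 + \<sigma>\<^sup>2)"
proof -
  \<comment> \<open>Expand (a - t)^2 with a - t = (a - m) - (t - m). The exponents
    \<open>2 * 1\<close> and \<open>2 * 0 + 1\<close> match the general even and odd moment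
    formulas.\<close>
  have "has_bochner_integral lborel
      (\<lambda>t. normal_density m \<sigma> t * (t - m) ^ (2 * 1) + ((a - m)\<^sup>2 * normal_density m \<sigma> t
        + (- 2 * (a - m)) * (normal_density m \<sigma> t * (t - m) ^ (2 * 0 + 1))))
      (fact (2 * 1) / ((2 / \<sigma>\<^sup>2) ^ 1 * fact 1) + ((a - m)\<^sup>2 * 1 + (- 2 * (a - m)) * 0))"
    using assms
    by (intro has_bochner_integral_add has_bochner_integral_mult_right
        normal_moment_even normal_moment_odd)
       (auto simp: has_bochner_integral_iff)
  then have "has_bochner_integral lborel (\<lambda>t. (a - t)\<^sup>2 * normal_density m \<sigma> t) ((a - m)\<^sup>2 + \<sigma>\<^sup>2)"
    by (rule has_bochner_integral_cong[THEN iffD1, rotated 3])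
       (auto simp: power2_eq_square algebra_simps)
  then show ?thesis
    by (subst nn_integral_eq_integral) (auto simp: has_bochner_integral_iff)
qed

lemma nn_integral_isotropic_density:
  fixes b :: "'a::euclidean_space"
  assumes "\<sigma> > 0"
  shows "(\<integral>\<^sup>+x. ennreal (isotropic_density b \<sigma> x) \<partial>lborel) = 1"
  using nn_integral_lborel_prod[of "\<lambda>e t. ennreal (normal_density (b \<bullet> e) \<sigma> t)"] assms
  by (simp add: isotropic_density_def prod_ennreal nn_integral_normal_density)

lemma borel_measurable_isotropic_density [measurable]:
  "isotropic_density b \<sigma> \<in> borel_measurable borel"
  unfolding isotropic_density_def[abs_def] by measurable

lemma nn_integral_square_isotropic_density:
  fixes a b :: "'a::euclidean_space"
  assumes "\<sigma> > 0"
  shows "(\<integral>\<^sup>+x. ennreal ((norm (a - x))\<^sup>2 * isotropic_density b \<sigma> x) \<partial>lborel) =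
    ennreal ((norm (a - b))\<^sup>2 + real DIM('a) * \<sigma>\<^sup>2)"
proof -
  \<comment> \<open>The squared factor sits only in coordinate \<open>i\<close>, so each summand of
    the squared norm times the density is a product of one-variable functions, and the other factors
    integrate to 1.\<close>
  define f where "f i e t = (if e = i then (a \<bullet> e - t)\<^sup>2 else 1) * normal_density (b \<bullet> e) \<sigma> t"
    for i e :: 'a and t
  have f_nonneg: "0 \<le> f i e t" for i e t by (simp add: f_def)
  have [measurable]: "f i e \<in> borel_measurable borel" for i e
    unfolding f_def[abs_def] by measurable
  have norm_eq: "(norm v)\<^sup>2 = (\<Sum>i\<in>Basis. (v \<bullet> i)\<^sup>2)" for v :: 'a
    unfolding power2_norm_eq_inner euclidean_inner[of v v] by (simp add: power2_eq_square)
  have "(norm (a - x))\<^sup>2 * isotropic_density b \<sigma> x = (\<Sum>i\<in>Basis. \<Prod>e\<in>Basis. f i e (x \<bullet> e))" for x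
    unfolding norm_eq isotropic_density_def f_def
    by (simp add: prod.distrib sum_distrib_right prod.If_cases inner_diff_left)
  then have "(\<integral>\<^sup>+x. ennreal ((norm (a - x))\<^sup>2 * isotropic_density b \<sigma> x) \<partial>lborel) =
      (\<integral>\<^sup>+x. (\<Sum>i\<in>Basis. \<Prod>e\<in>Basis. ennreal (f i e (x \<bullet> e))) \<partial>(lborel::'a measure))"
    by (simp add: prod_ennreal f_nonneg prod_nonneg)
  also have "\<dots> = (\<Sum>i\<in>Basis. \<integral>\<^sup>+x. (\<Prod>e\<in>Basis. ennreal (f i e (x \<bullet> e))) \<partial>(lborel::'a measure))"
    by (rule nn_integral_sum) measurable
  also have "\<dots> = (\<Sum>i\<in>Basis. \<Prod>e\<in>Basis. \<integral>\<^sup>+t. ennreal (f i e t) \<partial>lborel)"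
    by (intro sum.cong refl nn_integral_lborel_prod) auto
  also have "\<dots> = (\<Sum>i\<in>Basis. \<Prod>e\<in>Basis. if e = i then ennreal ((a \<bullet> e - b \<bullet> e)\<^sup>2 + \<sigma>\<^sup>2) else 1)"
    by (intro sum.cong prod.cong refl)
       (auto simp: f_def nn_integral_normal_density nn_integral_square_normal_density assms)
  also have "\<dots> = (\<Sum>i\<in>Basis. ennreal ((a \<bullet> i - b \<bullet> i)\<^sup>2 + \<sigma>\<^sup>2))"
    by (simp add: prod.delta)
  also have "\<dots> = ennreal ((norm (a - b))\<^sup>2 + real DIM('a) * \<sigma>\<^sup>2)"
    by (subst sum_ennreal) (auto simp: norm_eq sum.distrib inner_diff_left)
  finally show ?thesis .
qed

text \<open>With \<open>t\<close> the norm of an observation in dimension \<open>d\<close>, the case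
  \<open>j = 0\<close> is its marginal density under the single prior component \<open>g\<close>;
  \<open>j\<close> counts extra factors w = 1 / (g + 1).\<close>

definition scale_kernel :: "nat \<Rightarrow> nat \<Rightarrow> real \<Rightarrow> real \<Rightarrow> real" where
  "scale_kernel d j t g = (1 / (g + 1)) ^ j * (g + 1) powr (- real d / 2) * exp (- t\<^sup>2 / (2 * (g + 1)))"

text \<open>Completing the square in \<mu>: given \<open>g\<close>, the posterior is normal with
  mean s x and covariance s I, where s = g / (g + 1), and the factor left over is free of
  \<mu>.\<close>

lemma normal_times_prior_component:
  fixes \<mu> x :: "real ^ 'n"
  assumes g: "g > 0"
  shows "normal_vec_density \<mu> x * (g powr (- real CARD('n) / 2) * exp (- (norm \<mu>)\<^sup>2 / (2 * g))) =
    scale_kernel CARD('n) 0 (norm x) g * isotropic_density ((g / (g + 1)) *\<^sub>R x) (sqrt (g / (g + 1))) \<mu>"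
proof -
  define p where "p = - real CARD('n) / 2"
  define s where "s = g / (g + 1)"
  have s: "s > 0" using g by (simp add: s_def)
  have sq: "(sqrt s)\<^sup>2 = s" using s by simp
  have iso: "isotropic_density (s *\<^sub>R x) (sqrt s) \<mu> =
      (2 * pi * s) powr p * exp (- (norm (\<mu> - s *\<^sub>R x))\<^sup>2 / (2 * s))"
    using isotropic_density_eq[of "sqrt s" "s *\<^sub>R x" \<mu>] s by (simp add: p_def sq)
  have pw: "(2 * pi) powr p * g powr p = (g + 1) powr p * (2 * pi * s) powr p"
    using g by (simp add: powr_mult[symmetric] s_def)
  have ex: "- (norm (x - \<mu>))\<^sup>2 / 2 + - (norm \<mu>)\<^sup>2 / (2 * g) =
      - (norm x)\<^sup>2 / (2 * (g + 1)) + - (norm (\<mu> - s *\<^sub>R x))\<^sup>2 / (2 * s)"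
  proof -
    have "- (norm (x - \<mu>))\<^sup>2 / 2 + - (norm \<mu>)\<^sup>2 / (2 * g) =
        - (x \<bullet> x - 2 * (x \<bullet> \<mu>) + \<mu> \<bullet> \<mu>) / 2 - \<mu> \<bullet> \<mu> / (2 * g)"
      by (simp add: power2_norm_eq_inner inner_diff_left inner_diff_right inner_commute)
    moreover have "- (norm x)\<^sup>2 / (2 * (g + 1)) + - (norm (\<mu> - s *\<^sub>R x))\<^sup>2 / (2 * s) =
        - (x \<bullet> x) / (2 * (g + 1)) - (\<mu> \<bullet> \<mu> - 2 * s * (x \<bullet> \<mu>) + s\<^sup>2 * (x \<bullet> x)) / (2 * s)"
    proof -
      have "(norm (\<mu> - s *\<^sub>R x))\<^sup>2 = \<mu> \<bullet> \<mu> - 2 * s * (x \<bullet> \<mu>) + s\<^sup>2 * (x \<bullet> x)"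
        unfolding power2_norm_eq_inner
        by (simp add: inner_diff_left inner_diff_right inner_commute power2_eq_square)
      then show ?thesis
        by (simp only: power2_norm_eq_inner[of x] minus_divide_left diff_conv_add_uminus)
    qed
    \<comment> \<open>The inner products become free reals, so that only a rational identity
      remains.\<close>
    moreover have "- (X - 2 * Y + M) / 2 - M / (2 * g) =
        - X / (2 * (g + 1)) - (M - 2 * s * Y + s\<^sup>2 * X) / (2 * s)" for X Y M :: real
      using g by (simp add: s_def divide_simps) (simp add: power2_eq_square algebra_simps)
    ultimately show ?thesis by simp
  qed
  have "normal_vec_density \<mu> x * (g powr p * exp (- (norm \<mu>)\<^sup>2 / (2 * g))) =
      ((2 * pi) powr p * g powr p) * exp (- (norm (x - \<mu>))\<^sup>2 / 2 + - (norm \<mu>)\<^sup>2 / (2 * g))"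
    by (simp only: normal_vec_density_def p_def exp_add mult_ac)
  also have "\<dots> = scale_kernel CARD('n) 0 (norm x) g * isotropic_density (s *\<^sub>R x) (sqrt s) \<mu>"
    unfolding pw ex iso by (simp only: scale_kernel_def p_def exp_add mult_ac power_0 mult_1)
  finally show ?thesis unfolding p_def s_def .
qed

text \<open>The kernel is a multiple of the density of N(0, (g + 1) I). The second moment
  contributes d (g + 1), which for \<open>j = 2\<close> cancels one of the two factors 1 / (g +
  1).\<close>

lemma nn_integral_scale_kernel:
  assumes g: "g > 0"
  shows "(\<integral>\<^sup>+x. ennreal (scale_kernel CARD('n) j (norm (x :: real ^ 'n)) g) \<partial>lborel) =
    ennreal ((2 * pi) powr (real CARD('n) / 2) * (1 / (g + 1)) ^ j)"
    and nn_integral_square_scale_kernel: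
    "(\<integral>\<^sup>+x. ennreal ((norm x)\<^sup>2 * scale_kernel CARD('n) j (norm (x :: real ^ 'n)) g) \<partial>lborel) =
    ennreal ((2 * pi) powr (real CARD('n) / 2) * (real CARD('n) * (g + 1) * (1 / (g + 1)) ^ j))"
proof -
  let ?c = "(2 * pi) powr (real CARD('n) / 2) * (1 / (g + 1)) ^ j"
  have c: "?c \<ge> 0" using g by simp
  have eq: "scale_kernel CARD('n) j (norm x) g = ?c * isotropic_density 0 (sqrt (g + 1)) x"
    for x :: "real ^ 'n"
    using g by (subst isotropic_density_eq) (auto simp: scale_kernel_def powr_mult powr_minus, simp add: field_simps)
  show "(\<integral>\<^sup>+x. ennreal (scale_kernel CARD('n) j (norm (x :: real ^ 'n)) g) \<partial>lborel) = ennreal ?c"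
    unfolding eq ennreal_mult'[OF c]
    by (subst nn_integral_cmult) (use g in \<open>auto simp: nn_integral_isotropic_density\<close>)
  have "(\<integral>\<^sup>+x. ennreal ((norm x)\<^sup>2 * scale_kernel CARD('n) j (norm (x :: real ^ 'n)) g) \<partial>lborel) =
     (\<integral>\<^sup>+x. ennreal ?c * ennreal ((norm (0 - x))\<^sup>2 * isotropic_density 0 (sqrt (g + 1)) x) \<partial>(lborel :: (real ^ 'n) measure))"
    unfolding eq by (simp add: ennreal_mult'[symmetric] mult_ac)
  also have "\<dots> = ennreal ?c * ennreal (real CARD('n) * (g + 1))"
    by (subst nn_integral_cmult, measurable, subst nn_integral_square_isotropic_density)
       (use g in auto)
  finally show "(\<integral>\<^sup>+x. ennreal ((norm x)\<^sup>2 * scale_kernel CARD('n) j (norm (x :: real ^ 'n)) g) \<partial>lborel) =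
    ennreal ((2 * pi) powr (real CARD('n) / 2) * (real CARD('n) * (g + 1) * (1 / (g + 1)) ^ j))"
    by (simp only: ennreal_mult'[OF c, symmetric]) (simp add: mult_ac)
qed


section \<open>Posterior moments of the scale\<close>

lemma borel_measurable_scale_kernel [measurable]:
  assumes [measurable]: "f \<in> borel_measurable M" "h \<in> borel_measurable M"
  shows "(\<lambda>x. scale_kernel d j (f x) (h x)) \<in> borel_measurable M"
  unfolding scale_kernel_def[abs_def] by measurable

lemma scale_kernel_pos: "g > 0 \<Longrightarrow> 0 < scale_kernel d j t g"
  by (simp add: scale_kernel_def)

lemma scale_kernel_Suc: "scale_kernel d (Suc j) t g = 1 / (g + 1) * scale_kernel d j t g"
  by (simp add: scale_kernel_def)

lemma scale_kernel_Suc_le: "g > 0 \<Longrightarrow> scale_kernel d (Suc j) t g \<le> scale_kernel d j t g"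
  using scale_kernel_pos[of g d j t] by (simp add: scale_kernel_Suc divide_simps)

text \<open>A bound uniform in \<open>j\<close> and \<open>t\<close>, by the function whose integral
  the locale \<open>scale_mixture\<close> assumes finite.\<close>

lemma scale_kernel_le:
  assumes g: "g > 0"
  shows "scale_kernel d j t g \<le> (g + 1) powr (- real d / 2)"
proof -
  have "(1 / (g + 1)) ^ j \<le> 1" using g by (intro power_le_one) auto
  moreover have "exp (- t\<^sup>2 / (2 * (g + 1))) \<le> 1" using g by simp
  ultimately have "(1 / (g + 1)) ^ j * exp (- t\<^sup>2 / (2 * (g + 1))) \<le> 1 * 1"
    using g by (intro mult_mono) auto
  then have "(g + 1) powr (- real d / 2) * ((1 / (g + 1)) ^ j * exp (- t\<^sup>2 / (2 * (g + 1))))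
      \<le> (g + 1) powr (- real d / 2) * 1"
    by (intro mult_left_mono) auto
  then show ?thesis by (simp add: scale_kernel_def mult_ac)
qed

text \<open>For t = norm x in dimension \<open>d\<close>,
  \<open>moment \<nu> d j t / moment \<nu> d 0 t\<close> is E[w ^ j | x]. Real values are used
  because differences and quotients of moments occur.\<close>

definition moment :: "real measure \<Rightarrow> nat \<Rightarrow> nat \<Rightarrow> real \<Rightarrow> real" where
  "moment \<nu> d j t = (LINT g|\<nu>. scale_kernel d j t g)"

text \<open>The mixing measure lives on all of \<open>borel\<close> and charges only the positive
  reals, so that truncations are further instances. \<open>d\<close> is a plain number, identified
  with the dimension only where vectors occur.\<close>

locale scale_mixture =
  fixes \<nu> :: "real measure" and d :: nat
  assumes sets_mixing [measurable_cong]: "sets \<nu> = sets borel"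
    and pos: "AE g in \<nu>. 0 < g"
    and nonzero: "emeasure \<nu> UNIV \<noteq> 0"
    and finite: "(\<integral>\<^sup>+ g. ennreal ((g + 1) powr (- real d / 2)) \<partial>\<nu>) < \<infinity>"
begin

lemma space_mixing [simp]: "space \<nu> = UNIV"
  using sets_eq_imp_space_eq[OF sets_mixing] by simp

text \<open>On (0, n] the function (g + 1) powr (- d / 2) is at least (n + 1) powr (- d / 2). Hence
  truncated priors are proper, and the measure is sigma-finite, as Fubini requires.\<close>

lemma finite_atMost: "emeasure \<nu> {..real n} < \<infinity>"
proof -
  let ?p = "real d / 2"
  have "emeasure \<nu> {..real n} = (\<integral>\<^sup>+ g. indicator {..real n} g \<partial>\<nu>)"
    by simp
  also have "\<dots> \<le> (\<integral>\<^sup>+ g. ennreal ((real n + 1) powr ?p) * ennreal ((g + 1) powr (- ?p)) \<partial>\<nu>)"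
  proof (rule nn_integral_mono_AE, use pos in eventually_elim)
    fix g :: real assume g: "0 < g"
    have "1 \<le> (real n + 1) powr ?p * (g + 1) powr (- ?p)" if "g \<le> real n"
    proof -
      have "(g + 1) powr ?p \<le> (real n + 1) powr ?p" using that g by (intro powr_mono2) auto
      then show ?thesis using g by (simp add: powr_minus divide_simps)
    qed
    then show "indicator {..real n} g \<le>
        ennreal ((real n + 1) powr ?p) * ennreal ((g + 1) powr (- ?p))"
      by (auto simp: ennreal_mult'[symmetric] split: split_indicator)
  qed
  also have "\<dots> = ennreal ((real n + 1) powr ?p) * (\<integral>\<^sup>+ g. ennreal ((g + 1) powr (- ?p)) \<partial>\<nu>)"
    by (rule nn_integral_cmult) measurable
  also have "\<dots> < \<infinity>" using finite by (simp add: ennreal_mult_less_top)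
  finally show ?thesis .
qed

sublocale sigma_finite_measure \<nu>
proof
  let ?A = "range (\<lambda>n::nat. {..real n})"
  have "\<Union>?A = UNIV" by (auto intro: real_arch_simple)
  then show "\<exists>A. countable A \<and> A \<subseteq> sets \<nu> \<and> \<Union>A = space \<nu> \<and> (\<forall>a\<in>A. emeasure \<nu> a \<noteq> \<infinity>)"
    using finite_atMost by (intro exI[of _ ?A]) (auto simp: sets_mixing less_top)
qed

sublocale pair_sigma_finite \<nu> "lborel :: 'c::euclidean_space measure" ..

section \<open>Integrability, positivity and Cauchy-Schwarz for the moments\<close>

lemma integrable_scale_kernel: "integrable \<nu> (scale_kernel d j t)"
proof (rule Bochner_Integration.integrable_bound)
  show "integrable \<nu> (\<lambda>g. (g + 1) powr (- real d / 2))"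
    using finite by (intro integrableI_nonneg) auto
  show "AE g in \<nu>. norm (scale_kernel d j t g) \<le> norm ((g + 1) powr (- real d / 2))"
    using pos by eventually_elim (use scale_kernel_le scale_kernel_pos in \<open>auto simp: abs_of_pos\<close>)
qed measurable

lemma AE_scale_kernel_nonneg: "AE g in \<nu>. 0 \<le> scale_kernel d j t g"
  using pos by eventually_elim (simp add: scale_kernel_pos less_imp_le)

lemma nn_integral_scale_kernel_mixing: "(\<integral>\<^sup>+ g. ennreal (scale_kernel d j t g) \<partial>\<nu>) = ennreal (moment \<nu> d j t)"
  unfolding moment_def by (rule nn_integral_eq_integral[OF integrable_scale_kernel AE_scale_kernel_nonneg])

lemma moment_nonneg: "0 \<le> moment \<nu> d j t"
  unfolding moment_def by (rule integral_nonneg_AE[OF AE_scale_kernel_nonneg])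

text \<open>The kernel is positive almost everywhere and the measure is nonzero, so the integral
  cannot vanish. This justifies the divisions by the zeroth moment.\<close>

lemma moment_pos: "0 < moment \<nu> d j t"
proof (rule ccontr)
  assume "\<not> 0 < moment \<nu> d j t"
  then have "moment \<nu> d j t = 0"
    using moment_nonneg[of j t] by simp
  then have "AE g in \<nu>. scale_kernel d j t g = 0"
    using integral_nonneg_eq_0_iff_AE[OF integrable_scale_kernel AE_scale_kernel_nonneg]
    by (simp add: moment_def)
  with pos have "AE g in \<nu>. False"
    by eventually_elim (metis scale_kernel_pos less_irrefl)
  then show False using nonzero by (simp add: AE_iff_null null_sets_def)
qed

lemma moment_Suc_le: "moment \<nu> d (Suc j) t \<le> moment \<nu> d j t"
  unfolding moment_def
  by (rule integral_mono_AE[OF integrable_scale_kernel integrable_scale_kernel])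
     (use pos in eventually_elim, simp add: scale_kernel_Suc_le)

text \<open>Cauchy-Schwarz in the form E[w | x] ^ 2 \<le> E[w ^ 2 | x], scaled by the marginal
  density: the posterior variance of w is nonnegative.\<close>

lemma moment_square_le: "(moment \<nu> d 1 t)\<^sup>2 / moment \<nu> d 0 t \<le> moment \<nu> d 2 t"
proof -
  define m s q r where "m = moment \<nu> d 0 t" "s = moment \<nu> d 1 t" "q = moment \<nu> d 2 t" "r = s / m"
  have m: "m > 0" unfolding m_s_q_r_def by (rule moment_pos)
  \<comment> \<open>The integrand is (w - r) ^ 2 times the kernel, with r = s / m the posterior mean
    of w.\<close>
  have "0 \<le> (LINT g|\<nu>. scale_kernel d 2 t g + (- 2 * r) * scale_kernel d 1 t g + r\<^sup>2 * scale_kernel d 0 t g)"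
  proof (rule integral_nonneg_AE, use pos in eventually_elim)
    fix g :: real assume "0 < g"
    have "scale_kernel d 2 t g + (- 2 * r) * scale_kernel d 1 t g + r\<^sup>2 * scale_kernel d 0 t g =
        (1 / (g + 1) - r)\<^sup>2 * scale_kernel d 0 t g"
      by (simp add: scale_kernel_Suc numeral_2_eq_2 algebra_simps)
    also have "\<dots> \<ge> 0" using scale_kernel_pos[OF \<open>0 < g\<close>, of d 0 t] by simp
    finally show "0 \<le> scale_kernel d 2 t g + (- 2 * r) * scale_kernel d 1 t g + r\<^sup>2 * scale_kernel d 0 t g" .
  qed
  also have "\<dots> = q + (- 2 * r) * s + r\<^sup>2 * m"
    unfolding m_s_q_r_def moment_def
    by (simp add: integrable_scale_kernel Bochner_Integration.integral_add del: mult_minus_left)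
  also have "\<dots> = q - s\<^sup>2 / m" using m by (simp add: m_s_q_r_def(4) power2_eq_square field_simps)
  finally show ?thesis by (simp add: m_s_q_r_def)
qed

lemma borel_measurable_moment [measurable]: "moment \<nu> d j \<in> borel_measurable borel"
  unfolding moment_def[abs_def] by measurable

text \<open>The minimal posterior loss, multiplied by the marginal density.\<close>

definition posterior_risk :: "real \<Rightarrow> real" where
  "posterior_risk t = t\<^sup>2 * (moment \<nu> d 2 t - (moment \<nu> d 1 t)\<^sup>2 / moment \<nu> d 0 t) +
    real d * (moment \<nu> d 0 t - moment \<nu> d 1 t)"

lemma posterior_risk_nonneg: "0 \<le> posterior_risk t"
  using moment_square_le[of t] moment_Suc_le[of 0 t] by (auto simp: posterior_risk_def)

text \<open>Dropping the subtracted terms leaves two quantities whose integrals over x have closed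
  forms.\<close>

lemma posterior_risk_le: "posterior_risk t \<le> t\<^sup>2 * moment \<nu> d 2 t + real d * moment \<nu> d 0 t"
  unfolding posterior_risk_def using moment_pos[of _ t] moment_nonneg[of _ t]
  by (intro add_mono mult_left_mono) (auto simp: less_imp_le)

lemma borel_measurable_posterior_risk [measurable]: "posterior_risk \<in> borel_measurable borel"
  unfolding posterior_risk_def[abs_def] by measurable

lemma mixture_estimator_eq:
  fixes x :: "real ^ 'n"
  assumes dim: "d = CARD('n)"
  shows "mixture_estimator \<nu> x = (1 - moment \<nu> d 1 (norm x) / moment \<nu> d 0 (norm x)) *\<^sub>R x"
proof -
  have "(LINT g|\<nu>. (g + 1) powr (- real d / 2 - 1) * exp (- (norm x)\<^sup>2 / (2 * (g + 1)))) =
      moment \<nu> d 1 (norm x)"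
    unfolding moment_def
  proof (rule integral_cong_AE)
    show "AE g in \<nu>. (g + 1) powr (- real d / 2 - 1) * exp (- (norm x)\<^sup>2 / (2 * (g + 1))) =
        scale_kernel d 1 (norm x) g"
      using pos by eventually_elim (simp add: scale_kernel_def powr_diff)
  qed measurable
  then show ?thesis
    by (simp add: mixture_estimator_def moment_def scale_kernel_def dim)
qed

lemma borel_measurable_mixture_estimator:
  assumes "d = CARD('n)"
  shows "(mixture_estimator \<nu> :: real ^ 'n \<Rightarrow> real ^ 'n) \<in> borel_measurable borel"
  unfolding mixture_estimator_eq[OF assms, abs_def] by measurable

end

section \<open>Posterior loss and Bayes risk\<close>

lemma borel_measurable_normal_vec_density [measurable]:
  assumes [measurable]: "f \<in> borel_measurable M" "h \<in> borel_measurable M"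
  shows "(\<lambda>x. normal_vec_density (f x) (h x)) \<in> borel_measurable M"
  unfolding normal_vec_density_def by measurable

lemma normal_vec_density_nonneg [simp]: "0 \<le> normal_vec_density \<mu> x"
  by (simp add: normal_vec_density_def)

lemma nn_integral_normal_vec:
  fixes f :: "real ^ 'n \<Rightarrow> ennreal"
  assumes [measurable]: "f \<in> borel_measurable borel"
  shows "(\<integral>\<^sup>+x. f x \<partial>normal_vec \<mu>) = (\<integral>\<^sup>+x. ennreal (normal_vec_density \<mu> x) * f x \<partial>lborel)"
  unfolding normal_vec_def by (rule nn_integral_density) measurable

lemma sets_normal_vec [measurable_cong]: "sets (normal_vec \<mu>) = sets borel"
  by (simp add: normal_vec_def)

context scale_mixture
begin

lemma borel_measurable_mixture_prior [measurable]:
  "(mixture_prior \<nu> :: real ^ 'n \<Rightarrow> ennreal) \<in> borel_measurable borel"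
  unfolding mixture_prior_def[abs_def] by measurable

text \<open>Fubini moves the mixing integral outside, and each component then contributes the
  expectation of \<open>f\<close> under its own normal posterior. Taking \<open>f\<close> to be 1
  gives the marginal density, and the squared distance gives the loss.\<close>

lemma nn_integral_posterior:
  fixes x :: "real ^ 'n"
  assumes dim: "d = CARD('n)"
    and f[measurable]: "f \<in> borel_measurable borel" and f_nonneg: "\<And>\<mu>. 0 \<le> f \<mu>"
  shows "(\<integral>\<^sup>+\<mu>. ennreal (f \<mu>) * (ennreal (normal_vec_density \<mu> x) * mixture_prior \<nu> \<mu>) \<partial>lborel) =
    (\<integral>\<^sup>+g. ennreal (scale_kernel d 0 (norm x) g) * (\<integral>\<^sup>+\<mu>. ennreal (f \<mu> *
      isotropic_density ((g / (g + 1)) *\<^sub>R x) (sqrt (g / (g + 1))) \<mu>) \<partial>lborel) \<partial>\<nu>)"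
proof -
  let ?q = "\<lambda>g (\<mu> :: real ^ 'n). g powr (- real CARD('n) / 2) * exp (- (norm \<mu>)\<^sup>2 / (2 * g))"
  let ?G = "\<lambda>g. isotropic_density ((g / (g + 1)) *\<^sub>R x) (sqrt (g / (g + 1)))"
  have "(\<integral>\<^sup>+\<mu>. ennreal (f \<mu>) * (ennreal (normal_vec_density \<mu> x) * mixture_prior \<nu> \<mu>) \<partial>lborel) =
      (\<integral>\<^sup>+\<mu>. (\<integral>\<^sup>+g. ennreal (f \<mu> * (normal_vec_density \<mu> x * ?q g \<mu>)) \<partial>\<nu>) \<partial>lborel)"
    unfolding mixture_prior_def
    by (simp add: nn_integral_cmult[symmetric] ennreal_mult' f_nonneg)
  also have "\<dots> = (\<integral>\<^sup>+g. (\<integral>\<^sup>+\<mu>. ennreal (f \<mu> * (normal_vec_density \<mu> x * ?q g \<mu>)) \<partial>lborel) \<partial>\<nu>)"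
    by (rule Fubini') measurable
  also have "\<dots> = (\<integral>\<^sup>+g. ennreal (scale_kernel d 0 (norm x) g) * (\<integral>\<^sup>+\<mu>. ennreal (f \<mu> * ?G g \<mu>) \<partial>lborel) \<partial>\<nu>)"
  proof (rule nn_integral_cong_AE, use pos in eventually_elim)
    fix g :: real assume g: "0 < g"
    have "ennreal (f \<mu> * (normal_vec_density \<mu> x * ?q g \<mu>)) =
        ennreal (scale_kernel d 0 (norm x) g) * ennreal (f \<mu> * ?G g \<mu>)" for \<mu>
      unfolding normal_times_prior_component[OF g] dim
      by (subst ennreal_mult'[symmetric]) (use scale_kernel_pos[OF g] in \<open>auto simp: mult_ac less_imp_le\<close>)
    then show "(\<integral>\<^sup>+\<mu>. ennreal (f \<mu> * (normal_vec_density \<mu> x * ?q g \<mu>)) \<partial>lborel) =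
        ennreal (scale_kernel d 0 (norm x) g) * (\<integral>\<^sup>+\<mu>. ennreal (f \<mu> * ?G g \<mu>) \<partial>lborel)"
      by (simp add: nn_integral_cmult)
  qed
  finally show ?thesis .
qed

lemma marginal_density_mixture_prior:
  fixes x :: "real ^ 'n"
  assumes dim: "d = CARD('n)"
  shows "marginal_density (mixture_prior \<nu>) x = ennreal (moment \<nu> d 0 (norm x))"
proof -
  have "marginal_density (mixture_prior \<nu>) x =
      (\<integral>\<^sup>+\<mu>. ennreal 1 * (ennreal (normal_vec_density \<mu> x) * mixture_prior \<nu> \<mu>) \<partial>lborel)"
    by (simp add: marginal_density_def)
  also have "\<dots> = (\<integral>\<^sup>+g. ennreal (scale_kernel d 0 (norm x) g) \<partial>\<nu>)"
    unfolding nn_integral_posterior[OF dim borel_measurable_const zero_le_one]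
    by (rule nn_integral_cong_AE, use pos in eventually_elim)
       (simp add: nn_integral_isotropic_density)
  finally show ?thesis by (simp add: nn_integral_scale_kernel_mixing)
qed

text \<open>Given \<open>g\<close>, the expected loss is quadratic in w, so mixing yields a
  combination of three moments. Completing the square in \<open>a\<close> exhibits the mixture
  estimator as the minimizer.\<close>

lemma nn_integral_posterior_loss:
  fixes a x :: "real ^ 'n"
  assumes dim: "d = CARD('n)"
  shows "(\<integral>\<^sup>+\<mu>. ennreal ((norm (a - \<mu>))\<^sup>2) *
      (ennreal (normal_vec_density \<mu> x) * mixture_prior \<nu> \<mu>) \<partial>lborel) =
    ennreal (moment \<nu> d 0 (norm x) * (norm (a - mixture_estimator \<nu> x))\<^sup>2 + posterior_risk (norm x))"
    (is "?lhs = _")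
proof -
  \<comment> \<open>The coefficients of 1, w and w ^ 2 in the squared norm of a - (1 - w) x plus d
    (1 - w).\<close>
  define \<alpha> \<beta> \<gamma> where "\<alpha> = (norm (a - x))\<^sup>2 + real d" "\<beta> = 2 * ((a - x) \<bullet> x) - real d" "\<gamma> = (norm x)\<^sup>2"
  define m s q where "m = moment \<nu> d 0 (norm x)" "s = moment \<nu> d 1 (norm x)" "q = moment \<nu> d 2 (norm x)"
  let ?h = "\<lambda>g. \<alpha> * scale_kernel d 0 (norm x) g + \<beta> * scale_kernel d 1 (norm x) g + \<gamma> * scale_kernel d 2 (norm x) g"
  have sq: "(norm (a - x + r *\<^sub>R x))\<^sup>2 = (norm (a - x))\<^sup>2 + 2 * r * ((a - x) \<bullet> x) + r\<^sup>2 * (norm x)\<^sup>2" for r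
    unfolding power2_norm_eq_inner
    by (simp add: inner_add_left inner_add_right inner_diff_left inner_diff_right
        inner_commute power2_eq_square algebra_simps)
  have h_eq: "scale_kernel d 0 (norm x) g * ((norm (a - (g / (g + 1)) *\<^sub>R x))\<^sup>2 + real d * (g / (g + 1))) = ?h g"
    if g: "0 < g" for g
  proof -
    define w where "w = 1 / (g + 1)"
    have gw: "g / (g + 1) = 1 - w" using g by (simp add: w_def field_simps)
    have "a - (1 - w) *\<^sub>R x = a - x + w *\<^sub>R x" by (simp add: algebra_simps)
    then have norm_w: "(norm (a - (1 - w) *\<^sub>R x))\<^sup>2 =
        (norm (a - x))\<^sup>2 + 2 * w * ((a - x) \<bullet> x) + w\<^sup>2 * (norm x)\<^sup>2"
      by (simp only: sq)
    have "scale_kernel d 1 (norm x) g = w * scale_kernel d 0 (norm x) g"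
      "scale_kernel d 2 (norm x) g = w * w * scale_kernel d 0 (norm x) g"
      by (simp_all add: scale_kernel_Suc numeral_2_eq_2 w_def)
    then show ?thesis
      unfolding gw norm_w \<alpha>_\<beta>_\<gamma>_def by (simp only: power2_eq_square[of w]) (simp add: algebra_simps)
  qed
  have "?lhs = (\<integral>\<^sup>+g. ennreal (?h g) \<partial>\<nu>)"
    unfolding nn_integral_posterior[OF dim, of "\<lambda>\<mu>. (norm (a - \<mu>))\<^sup>2", simplified]
  proof (rule nn_integral_cong_AE, use pos in eventually_elim)
    fix g :: real assume g: "0 < g"
    have "(\<integral>\<^sup>+\<mu>. ennreal ((norm (a - \<mu>))\<^sup>2 * isotropic_density ((g / (g + 1)) *\<^sub>R x)
        (sqrt (g / (g + 1))) \<mu>) \<partial>lborel) =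
        ennreal ((norm (a - (g / (g + 1)) *\<^sub>R x))\<^sup>2 + real d * (g / (g + 1)))"
      using g by (subst nn_integral_square_isotropic_density) (auto simp: dim)
    then show "ennreal (scale_kernel d 0 (norm x) g) * (\<integral>\<^sup>+\<mu>. ennreal ((norm (a - \<mu>))\<^sup>2 *
        isotropic_density ((g / (g + 1)) *\<^sub>R x) (sqrt (g / (g + 1))) \<mu>) \<partial>lborel) = ennreal (?h g)"
      by (simp only: ennreal_mult'[OF less_imp_le[OF scale_kernel_pos[OF g]], symmetric] h_eq[OF g])
  qed
  also have "\<dots> = ennreal (LINT g|\<nu>. ?h g)"
  proof (rule nn_integral_eq_integral)
    show "integrable \<nu> ?h" by (simp add: integrable_scale_kernel)
    \<comment> \<open>\<beta> may be negative; nonnegativity is read off the squared-distance form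
      in \<open>h_eq\<close>.\<close>
    show "AE g in \<nu>. 0 \<le> ?h g"
      using pos by eventually_elim
        (simp only: h_eq[symmetric], auto intro!: mult_nonneg_nonneg add_nonneg_nonneg less_imp_le[OF scale_kernel_pos])
  qed
  also have "(LINT g|\<nu>. ?h g) = \<alpha> * m + \<beta> * s + \<gamma> * q"
    unfolding m_s_q_def moment_def by (simp add: integrable_scale_kernel)
  also have "\<dots> = m * (norm (a - mixture_estimator \<nu> x))\<^sup>2 + posterior_risk (norm x)"
  proof -
    have m: "m > 0" unfolding m_s_q_def by (rule moment_pos)
    have "a - mixture_estimator \<nu> x = a - x + (s / m) *\<^sub>R x"
      unfolding mixture_estimator_eq[OF dim] m_s_q_def by (simp add: algebra_simps)
    then have "(norm (a - mixture_estimator \<nu> x))\<^sup>2 =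
        (norm (a - x))\<^sup>2 + 2 * (s / m) * ((a - x) \<bullet> x) + (s / m)\<^sup>2 * (norm x)\<^sup>2"
      by (simp only: sq)
    then show ?thesis
      using m unfolding posterior_risk_def m_s_q_def[symmetric] \<alpha>_\<beta>_\<gamma>_def
      by (simp add: power2_eq_square field_simps)
  qed
  finally show ?thesis unfolding m_s_q_def .
qed

text \<open>The posterior loss is the squared distance to the mixture estimator plus a finite term
  free of the action.\<close>

lemma generalized_Bayes_mixture_estimator:
  assumes dim: "d = CARD('n)"
  shows "generalized_Bayes (mixture_prior \<nu>) (mixture_estimator \<nu> :: real ^ 'n \<Rightarrow> real ^ 'n)"
  unfolding generalized_Bayes_def estimator_def
proof (intro conjI allI)
  show "mixture_estimator \<nu> \<in> borel_measurable (borel :: (real ^ 'n) measure)"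
    by (rule borel_measurable_mixture_estimator[OF dim])
  fix x a :: "real ^ 'n"
  have m: "moment \<nu> d 0 (norm x) > 0" by (rule moment_pos)
  show "0 < marginal_density (mixture_prior \<nu>) x" "marginal_density (mixture_prior \<nu>) x < \<infinity>"
    using m by (simp_all add: marginal_density_mixture_prior[OF dim])
  have loss: "posterior_loss (mixture_prior \<nu>) x b = ennreal ((norm (b - mixture_estimator \<nu> x))\<^sup>2 +
      posterior_risk (norm x) / moment \<nu> d 0 (norm x))" for b
    using m posterior_risk_nonneg[of "norm x"]
    by (simp add: posterior_loss_def nn_integral_posterior_loss[OF dim]
        marginal_density_mixture_prior[OF dim] divide_ennreal add_divide_distrib del: ennreal_plus)
  show "posterior_loss (mixture_prior \<nu>) x (mixture_estimator \<nu> x) < \<infinity>"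
    by (simp add: loss)
  show "posterior_loss (mixture_prior \<nu>) x (mixture_estimator \<nu> x) \<le> posterior_loss (mixture_prior \<nu>) x a"
    unfolding loss by (rule ennreal_leI) simp
qed

text \<open>Tonelli exchanges parameter and observation. The integrand stays general because both
  the loss and the squared distance between two estimators are inserted later.\<close>

lemma nn_integral_prior_normal:
  fixes h :: "real ^ 'n \<Rightarrow> real ^ 'n \<Rightarrow> ennreal"
  assumes [measurable]: "case_prod h \<in> borel_measurable (borel \<Otimes>\<^sub>M borel)"
  shows "(\<integral>\<^sup>+\<mu>. mixture_prior \<nu> \<mu> * (\<integral>\<^sup>+x. h \<mu> x \<partial>normal_vec \<mu>) \<partial>lborel) =
    (\<integral>\<^sup>+x. (\<integral>\<^sup>+\<mu>. h \<mu> x * (ennreal (normal_vec_density \<mu> x) * mixture_prior \<nu> \<mu>) \<partial>lborel) \<partial>lborel)"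
proof -
  have "(\<integral>\<^sup>+\<mu>. mixture_prior \<nu> \<mu> * (\<integral>\<^sup>+x. h \<mu> x \<partial>normal_vec \<mu>) \<partial>lborel) =
      (\<integral>\<^sup>+\<mu>. (\<integral>\<^sup>+x. h \<mu> x * (ennreal (normal_vec_density \<mu> x) * mixture_prior \<nu> \<mu>) \<partial>lborel) \<partial>lborel)"
    by (intro nn_integral_cong)
       (simp add: nn_integral_normal_vec nn_integral_cmult[symmetric] mult_ac)
  also have "\<dots> = (\<integral>\<^sup>+x. (\<integral>\<^sup>+\<mu>. h \<mu> x * (ennreal (normal_vec_density \<mu> x) * mixture_prior \<nu> \<mu>) \<partial>lborel) \<partial>lborel)"
    by (rule lborel_pair.Fubini'[symmetric]) measurable
  finally show ?thesis .
qed

text \<open>The second summand is the minimal Bayes risk, attained by the mixture estimator; the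
  first is the excess of \<delta> over it.\<close>

lemma Bayes_risk_eq:
  fixes \<delta> :: "real ^ 'n \<Rightarrow> real ^ 'n"
  assumes dim: "d = CARD('n)" and [measurable]: "\<delta> \<in> borel_measurable borel"
  shows "(\<integral>\<^sup>+\<mu>. mixture_prior \<nu> \<mu> * risk \<mu> \<delta> \<partial>lborel) =
    (\<integral>\<^sup>+x. ennreal (moment \<nu> d 0 (norm x) * (norm (\<delta> x - mixture_estimator \<nu> x))\<^sup>2) \<partial>lborel) +
    (\<integral>\<^sup>+x. ennreal (posterior_risk (norm (x :: real ^ 'n))) \<partial>lborel)"
proof -
  note [measurable] = borel_measurable_mixture_estimator[OF dim]
  have "(\<integral>\<^sup>+\<mu>. mixture_prior \<nu> \<mu> * risk \<mu> \<delta> \<partial>lborel) =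
      (\<integral>\<^sup>+x. ennreal (moment \<nu> d 0 (norm x) * (norm (\<delta> x - mixture_estimator \<nu> x))\<^sup>2) +
        ennreal (posterior_risk (norm (x :: real ^ 'n))) \<partial>lborel)"
    unfolding risk_def
    by (subst nn_integral_prior_normal, measurable)
       (simp add: nn_integral_posterior_loss[OF dim] posterior_risk_nonneg moment_nonneg)
  also have "\<dots> = (\<integral>\<^sup>+x. ennreal (moment \<nu> d 0 (norm x) * (norm (\<delta> x - mixture_estimator \<nu> x))\<^sup>2) \<partial>lborel) +
    (\<integral>\<^sup>+x. ennreal (posterior_risk (norm (x :: real ^ 'n))) \<partial>lborel)"
    by (rule nn_integral_add) measurable
  finally show ?thesis .
qed

section \<open>Integrals of the marginal density and of the dominating function\<close>

lemma nn_integral_moment: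
  assumes dim: "d = CARD('n)"
  shows "(\<integral>\<^sup>+x. ennreal (moment \<nu> d 0 (norm (x :: real ^ 'n))) \<partial>lborel) =
    ennreal ((2 * pi) powr (real d / 2)) * emeasure \<nu> UNIV"
proof -
  have "(\<integral>\<^sup>+x. ennreal (moment \<nu> d 0 (norm (x :: real ^ 'n))) \<partial>lborel) =
      (\<integral>\<^sup>+g. (\<integral>\<^sup>+x. ennreal (scale_kernel d 0 (norm (x :: real ^ 'n)) g) \<partial>lborel) \<partial>\<nu>)"
    unfolding nn_integral_scale_kernel_mixing[symmetric] by (rule Fubini') measurable
  also have "\<dots> = (\<integral>\<^sup>+g. ennreal ((2 * pi) powr (real d / 2)) \<partial>\<nu>)"
    unfolding dim
    by (rule nn_integral_cong_AE, use pos in eventually_elim) (simp add: nn_integral_scale_kernel)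
  finally show ?thesis by simp
qed

text \<open>The condition on the integral of 1 / (g + 1) enters through this identity: the second
  moment d (g + 1) times w ^ 2 leaves d w.\<close>

lemma nn_integral_square_moment:
  assumes dim: "d = CARD('n)"
  shows "(\<integral>\<^sup>+x. ennreal ((norm x)\<^sup>2 * moment \<nu> d 2 (norm (x :: real ^ 'n))) \<partial>lborel) =
    ennreal ((2 * pi) powr (real d / 2) * real d) * (\<integral>\<^sup>+g. ennreal (1 / (g + 1)) \<partial>\<nu>)"
proof -
  have "(\<integral>\<^sup>+x. ennreal ((norm x)\<^sup>2 * moment \<nu> d 2 (norm (x :: real ^ 'n))) \<partial>lborel) =
      (\<integral>\<^sup>+x. (\<integral>\<^sup>+g. ennreal ((norm x)\<^sup>2 * scale_kernel d 2 (norm (x :: real ^ 'n)) g) \<partial>\<nu>) \<partial>lborel)"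
    by (simp add: ennreal_mult' nn_integral_scale_kernel_mixing nn_integral_cmult)
  also have "\<dots> = (\<integral>\<^sup>+g. (\<integral>\<^sup>+x. ennreal ((norm x)\<^sup>2 * scale_kernel d 2 (norm (x :: real ^ 'n)) g) \<partial>lborel) \<partial>\<nu>)"
    by (rule Fubini') measurable
  also have "\<dots> = (\<integral>\<^sup>+g. ennreal ((2 * pi) powr (real d / 2) * real d) * ennreal (1 / (g + 1)) \<partial>\<nu>)"
  proof (rule nn_integral_cong_AE, use pos in eventually_elim)
    fix g :: real assume g: "0 < g"
    have "(g + 1) * (1 / (g + 1))\<^sup>2 = 1 / (g + 1)"
      using g by (simp add: power2_eq_square)
    then show "(\<integral>\<^sup>+x. ennreal ((norm x)\<^sup>2 * scale_kernel d 2 (norm (x :: real ^ 'n)) g) \<partial>lborel) =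
        ennreal ((2 * pi) powr (real d / 2) * real d) * ennreal (1 / (g + 1))"
      unfolding dim nn_integral_square_scale_kernel[OF g]
      by (subst ennreal_mult'[symmetric]) (simp_all add: mult.assoc)
  qed
  also have "\<dots> = ennreal ((2 * pi) powr (real d / 2) * real d) * (\<integral>\<^sup>+g. ennreal (1 / (g + 1)) \<partial>\<nu>)"
    by (rule nn_integral_cmult) measurable
  finally show ?thesis .
qed

text \<open>As w \<le> 1, the bound in \<open>posterior_risk_le\<close> integrates to at most a
  multiple of the total mass. Finiteness is what permits cancelling the minimal Bayes risk.\<close>

lemma nn_integral_posterior_risk_finite:
  assumes dim: "d = CARD('n)" and fin: "emeasure \<nu> UNIV < \<infinity>"
  shows "(\<integral>\<^sup>+x. ennreal (posterior_risk (norm (x :: real ^ 'n))) \<partial>lborel) < \<infinity>"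
proof -
  have "(\<integral>\<^sup>+g. ennreal (1 / (g + 1)) \<partial>\<nu>) \<le> (\<integral>\<^sup>+g. 1 \<partial>\<nu>)"
    by (rule nn_integral_mono_AE, use pos in eventually_elim) (simp add: divide_simps)
  with fin have "(\<integral>\<^sup>+g. ennreal (1 / (g + 1)) \<partial>\<nu>) < \<infinity>"
    by (simp add: le_less_trans)
  then have *: "(\<integral>\<^sup>+x. ennreal ((norm x)\<^sup>2 * moment \<nu> d 2 (norm (x :: real ^ 'n))) \<partial>lborel) < \<infinity>"
    "(\<integral>\<^sup>+x. ennreal (moment \<nu> d 0 (norm (x :: real ^ 'n))) \<partial>lborel) < \<infinity>"
    unfolding nn_integral_square_moment[OF dim] nn_integral_moment[OF dim]
    using fin by (simp_all add: ennreal_mult_less_top)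
  have "(\<integral>\<^sup>+x. ennreal (posterior_risk (norm (x :: real ^ 'n))) \<partial>lborel) \<le>
      (\<integral>\<^sup>+x. ennreal ((norm x)\<^sup>2 * moment \<nu> d 2 (norm (x :: real ^ 'n))) +
        ennreal (real d) * ennreal (moment \<nu> d 0 (norm x)) \<partial>lborel)"
  proof (rule nn_integral_mono)
    fix x :: "real ^ 'n"
    have "ennreal (posterior_risk (norm x)) \<le>
        ennreal ((norm x)\<^sup>2 * moment \<nu> d 2 (norm x) + real d * moment \<nu> d 0 (norm x))"
      by (intro ennreal_leI posterior_risk_le)
    then show "ennreal (posterior_risk (norm x)) \<le> ennreal ((norm x)\<^sup>2 * moment \<nu> d 2 (norm x)) +
        ennreal (real d) * ennreal (moment \<nu> d 0 (norm x))"
      by (simp add: moment_nonneg ennreal_mult')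
  qed
  also have "\<dots> = (\<integral>\<^sup>+x. ennreal ((norm x)\<^sup>2 * moment \<nu> d 2 (norm (x :: real ^ 'n))) \<partial>lborel) +
      ennreal (real d) * (\<integral>\<^sup>+x. ennreal (moment \<nu> d 0 (norm (x :: real ^ 'n))) \<partial>lborel)"
    by (subst nn_integral_add, measurable, subst nn_integral_cmult, measurable)
  also have "\<dots> < \<infinity>" using * by (simp add: ennreal_mult_less_top)
  finally show ?thesis .
qed

text \<open>The midpoint gains a quarter of the squared distance over \<delta>, yet its Bayes risk
  is at least the minimum, so the gain cannot exceed the excess of \<delta>. Applied later with a
  truncated mixing measure and \<delta> the estimator of the full one.\<close>

lemma dominating_estimator_distance_le:
  fixes \<delta> \<delta>' :: "real ^ 'n \<Rightarrow> real ^ 'n"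
  assumes dim: "d = CARD('n)" and fin: "emeasure \<nu> UNIV < \<infinity>"
    and [measurable]: "\<delta> \<in> borel_measurable borel" "\<delta>' \<in> borel_measurable borel"
    and le: "\<And>\<mu>. risk \<mu> \<delta>' \<le> risk \<mu> \<delta>"
  shows "(\<integral>\<^sup>+x. ennreal (moment \<nu> d 0 (norm x) * (norm (\<delta> x - \<delta>' x))\<^sup>2 / 4) \<partial>lborel) \<le>
    (\<integral>\<^sup>+x. ennreal (moment \<nu> d 0 (norm x) * (norm (\<delta> x - mixture_estimator \<nu> x))\<^sup>2) \<partial>lborel)"
    (is "?Q \<le> ?D")
proof -
  define \<delta>'' where "\<delta>'' x = (1 / 2) *\<^sub>R (\<delta> x + \<delta>' x)" for x
  have [measurable]: "\<delta>'' \<in> borel_measurable borel"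
    unfolding \<delta>''_def[abs_def] by measurable
  let ?dist = "\<lambda>\<mu>. \<integral>\<^sup>+x. ennreal ((norm (\<delta> x - \<delta>' x))\<^sup>2 / 4) \<partial>normal_vec \<mu>"
  let ?C = "\<integral>\<^sup>+x. ennreal (posterior_risk (norm (x :: real ^ 'n))) \<partial>lborel"
  have parallelogram: "(norm (\<delta>'' x - \<mu>))\<^sup>2 + (norm (\<delta> x - \<delta>' x))\<^sup>2 / 4 =
      (norm (\<delta> x - \<mu>))\<^sup>2 / 2 + (norm (\<delta>' x - \<mu>))\<^sup>2 / 2" for x \<mu>
    unfolding power2_norm_eq_inner \<delta>''_def
    by (simp add: inner_add_left inner_add_right inner_diff_left inner_diff_right
        inner_commute field_simps)
  \<comment> \<open>Kept additive rather than as a difference, since risks may be infinite.\<close>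
  have "risk \<mu> \<delta>'' + ?dist \<mu> \<le> risk \<mu> \<delta>" for \<mu>
  proof -
    have "risk \<mu> \<delta>'' + ?dist \<mu> =
        (\<integral>\<^sup>+x. ennreal ((norm (\<delta>'' x - \<mu>))\<^sup>2) + ennreal ((norm (\<delta> x - \<delta>' x))\<^sup>2 / 4) \<partial>normal_vec \<mu>)"
      unfolding risk_def by (rule nn_integral_add[symmetric]) measurable
    also have "\<dots> = (\<integral>\<^sup>+x. ennreal (1 / 2) * ennreal ((norm (\<delta> x - \<mu>))\<^sup>2) +
        ennreal (1 / 2) * ennreal ((norm (\<delta>' x - \<mu>))\<^sup>2) \<partial>normal_vec \<mu>)"
    proof (rule nn_integral_cong)
      fix x
      have "ennreal ((norm (\<delta>'' x - \<mu>))\<^sup>2) + ennreal ((norm (\<delta> x - \<delta>' x))\<^sup>2 / 4) =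
          ennreal (1 / 2 * (norm (\<delta> x - \<mu>))\<^sup>2 + 1 / 2 * (norm (\<delta>' x - \<mu>))\<^sup>2)"
        by (subst ennreal_plus[symmetric]) (auto simp: parallelogram)
      also have "\<dots> = ennreal (1 / 2 * (norm (\<delta> x - \<mu>))\<^sup>2) + ennreal (1 / 2 * (norm (\<delta>' x - \<mu>))\<^sup>2)"
        by (rule ennreal_plus) auto
      finally show "ennreal ((norm (\<delta>'' x - \<mu>))\<^sup>2) + ennreal ((norm (\<delta> x - \<delta>' x))\<^sup>2 / 4) =
          ennreal (1 / 2) * ennreal ((norm (\<delta> x - \<mu>))\<^sup>2) +
          ennreal (1 / 2) * ennreal ((norm (\<delta>' x - \<mu>))\<^sup>2)"
        using ennreal_mult'[of "1 / 2"] by (simp only: zero_le_divide_1_iff zero_le_numeral)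
    qed
    also have "\<dots> = ennreal (1 / 2) * risk \<mu> \<delta> + ennreal (1 / 2) * risk \<mu> \<delta>'"
      unfolding risk_def
      by (subst nn_integral_add, measurable, subst (1 2) nn_integral_cmult, measurable)
    also have "\<dots> \<le> ennreal (1 / 2) * risk \<mu> \<delta> + ennreal (1 / 2) * risk \<mu> \<delta>"
      by (intro add_mono mult_left_mono le) auto
    also have "\<dots> = risk \<mu> \<delta>"
    proof -
      have "ennreal (1 / 2) + ennreal (1 / 2) = 1"
        by (subst ennreal_plus[symmetric]) auto
      then show ?thesis by (simp only: distrib_right[symmetric] mult_1)
    qed
    finally show ?thesis .
  qed
  then have "(\<integral>\<^sup>+\<mu>. mixture_prior \<nu> \<mu> * (risk \<mu> \<delta>'' + ?dist \<mu>) \<partial>lborel) \<le>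
      (\<integral>\<^sup>+\<mu>. mixture_prior \<nu> \<mu> * risk \<mu> \<delta> \<partial>lborel)"
    by (intro nn_integral_mono mult_left_mono) auto
  moreover have [measurable]: "(\<lambda>\<mu>. risk \<mu> \<delta>'') \<in> borel_measurable borel"
    unfolding risk_def by (simp add: nn_integral_normal_vec)
  moreover have [measurable]: "?dist \<in> borel_measurable borel"
    by (simp add: nn_integral_normal_vec)
  ultimately have total: "(\<integral>\<^sup>+\<mu>. mixture_prior \<nu> \<mu> * risk \<mu> \<delta>'' \<partial>lborel) +
      (\<integral>\<^sup>+\<mu>. mixture_prior \<nu> \<mu> * ?dist \<mu> \<partial>lborel) \<le> ?D + ?C"
    by (simp add: distrib_left nn_integral_add Bayes_risk_eq[OF dim])
  \<comment> \<open>The distance does not depend on \<mu>, so integrating \<mu> out leaves the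
    marginal density as weight.\<close>
  have Q: "(\<integral>\<^sup>+\<mu>. mixture_prior \<nu> \<mu> * ?dist \<mu> \<partial>lborel) = ?Q"
  proof -
    have "(\<integral>\<^sup>+\<mu>. mixture_prior \<nu> \<mu> * ?dist \<mu> \<partial>lborel) =
        (\<integral>\<^sup>+x. ennreal ((norm (\<delta> x - \<delta>' x))\<^sup>2 / 4) * marginal_density (mixture_prior \<nu>) x \<partial>lborel)"
      unfolding marginal_density_def
      by (subst nn_integral_prior_normal, measurable) (simp add: nn_integral_cmult)
    then show ?thesis
      by (simp add: marginal_density_mixture_prior[OF dim] ennreal_mult'[symmetric] moment_nonneg mult_ac)
  qed
  \<comment> \<open>The excess of the midpoint is discarded, which leaves the minimal Bayes risk
    \<open>?C\<close>.\<close>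
  have "?C + ?Q \<le> (\<integral>\<^sup>+\<mu>. mixture_prior \<nu> \<mu> * risk \<mu> \<delta>'' \<partial>lborel) + ?Q"
    by (rule add_right_mono) (simp add: Bayes_risk_eq[OF dim])
  also have "\<dots> \<le> ?C + ?D"
    using total unfolding Q by (simp only: add.commute)
  finally have "?C + ?Q \<le> ?C + ?D" .
  then show ?thesis
    using nn_integral_posterior_risk_finite[OF dim fin] by (auto simp: ennreal_add_left_cancel_le)
qed

end

section \<open>Truncated mixing measures and admissibility\<close>

text \<open>A density on the same space, rather than a restricted measure, keeps the
  \<sigma>-algebra, so that the locale applies again.\<close>

definition truncate :: "real measure \<Rightarrow> nat \<Rightarrow> real measure" where
  "truncate \<nu> n = density \<nu> (\<lambda>g. ennreal (indicator {..real n} g))"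

context scale_mixture
begin

lemma emeasure_truncate: "emeasure (truncate \<nu> n) UNIV = emeasure \<nu> {..real n}"
  by (simp add: truncate_def emeasure_density ennreal_indicator)

lemma nn_integral_truncate_le:
  assumes [measurable]: "f \<in> borel_measurable borel"
  shows "(\<integral>\<^sup>+g. f g \<partial>truncate \<nu> n) \<le> (\<integral>\<^sup>+g. f g \<partial>\<nu>)"
  unfolding truncate_def
  by (subst nn_integral_density) (auto intro!: nn_integral_mono split: split_indicator)

lemma scale_mixture_truncate:
  assumes "emeasure \<nu> {..real n} \<noteq> 0"
  shows "scale_mixture (truncate \<nu> n) d"
proof
  show "sets (truncate \<nu> n) = sets borel"
    by (simp add: truncate_def sets_mixing)
  show "AE g in truncate \<nu> n. 0 < g"
    unfolding truncate_def by (subst AE_density) (use pos in auto)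
  show "emeasure (truncate \<nu> n) UNIV \<noteq> 0"
    using assms by (simp add: emeasure_truncate)
  show "(\<integral>\<^sup>+ g. ennreal ((g + 1) powr (- real d / 2)) \<partial>truncate \<nu> n) < \<infinity>"
    by (rule le_less_trans[OF nn_integral_truncate_le finite]) measurable
qed

section \<open>Moments of the truncated measures\<close>

lemma integrable_truncated: "integrable \<nu> (\<lambda>g. indicator {..real n} g * scale_kernel d j t g)"
  using integrable_mult_indicator[OF _ integrable_scale_kernel, of "{..real n}"]
  by (simp add: sets_mixing)

lemma moment_truncate: "moment (truncate \<nu> n) d j t = (LINT g|\<nu>. indicator {..real n} g * scale_kernel d j t g)"
  unfolding moment_def truncate_def by (subst integral_density) auto

text \<open>Lets a weight fixed at one truncation level be replaced by the larger weight at any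
  later level.\<close>

lemma moment_truncate_mono:
  assumes "n \<le> n'"
  shows "moment (truncate \<nu> n) d j t \<le> moment (truncate \<nu> n') d j t"
  unfolding moment_truncate
proof (rule integral_mono_AE)
  show "AE g in \<nu>. indicator {..real n} g * scale_kernel d j t g \<le>
      indicator {..real n'} g * scale_kernel d j t g"
    using AE_scale_kernel_nonneg by eventually_elim (use assms in \<open>auto split: split_indicator\<close>)
qed (intro integrable_truncated integrable_scale_kernel)+

lemma moment_truncate_le: "moment (truncate \<nu> n) d j t \<le> moment \<nu> d j t"
  unfolding moment_truncate moment_def[of \<nu>]
proof (rule integral_mono_AE)
  show "AE g in \<nu>. indicator {..real n} g * scale_kernel d j t g \<le> scale_kernel d j t g"
    using AE_scale_kernel_nonneg by eventually_elim (auto split: split_indicator)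
qed (intro integrable_truncated integrable_scale_kernel)+

text \<open>The kernel itself dominates, and at each \<open>g\<close> the truncated kernel is
  eventually equal to it.\<close>

lemma moment_truncate_tendsto: "(\<lambda>n. moment (truncate \<nu> n) d j t) \<longlonglongrightarrow> moment \<nu> d j t"
  unfolding moment_truncate moment_def[of \<nu>]
proof (rule integral_dominated_convergence)
  show "integrable \<nu> (scale_kernel d j t)" by (rule integrable_scale_kernel)
  show "AE g in \<nu>. (\<lambda>n. indicator {..real n} g * scale_kernel d j t g) \<longlonglongrightarrow> scale_kernel d j t g"
  proof (rule AE_I2)
    fix g :: real
    obtain N where "g \<le> real N" using real_arch_simple by blast
    then have "\<forall>\<^sub>F n in sequentially. indicator {..real n} g * scale_kernel d j t g = scale_kernel d j t g"
      by (intro eventually_sequentiallyI[of N]) (auto split: split_indicator)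
    then show "(\<lambda>n. indicator {..real n} g * scale_kernel d j t g) \<longlonglongrightarrow> scale_kernel d j t g"
      by (rule tendsto_eventually)
  qed
  show "AE g in \<nu>. norm (indicator {..real n} g * scale_kernel d j t g) \<le> scale_kernel d j t g" for n
    using AE_scale_kernel_nonneg by eventually_elim (auto split: split_indicator)
qed measurable

text \<open>The half-lines cover the real line, so they cannot all be null. From such an index on,
  every truncation is again a \<open>scale_mixture\<close>.\<close>

lemma exists_truncation_nonzero: "\<exists>N. emeasure \<nu> {..real N} \<noteq> 0"
proof (rule ccontr)
  assume "\<not> ?thesis"
  then have "(\<Union>n::nat. {..real n}) \<in> null_sets \<nu>"
    by (intro null_sets_UN) (auto simp: null_sets_def)
  moreover have "(\<Union>n::nat. {..real n}) = UNIV" by (auto intro: real_arch_simple)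
  ultimately show False using nonzero by (simp add: null_sets_def)
qed

text \<open>Provides a dominating function free of \<open>n\<close>. The factor 4 comes from (a - b)
  ^ 2 \<le> 2 a ^ 2 + 2 b ^ 2, where Cauchy-Schwarz bounds each weighted square by the second
  moment.\<close>

lemma truncation_gap_le:
  fixes x :: "real ^ 'n"
  assumes dim: "d = CARD('n)" and n: "emeasure \<nu> {..real n} \<noteq> 0"
  shows "moment (truncate \<nu> n) d 0 (norm x) *
      (norm (mixture_estimator \<nu> x - mixture_estimator (truncate \<nu> n) x))\<^sup>2 \<le>
    4 * ((norm x)\<^sup>2 * moment \<nu> d 2 (norm x))"
proof -
  interpret T: scale_mixture "truncate \<nu> n" d by (rule scale_mixture_truncate[OF n])
  define m s q where "m = moment \<nu> d 0 (norm x)" "s = moment \<nu> d 1 (norm x)" "q = moment \<nu> d 2 (norm x)"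
  define m' s' q' where "m' = moment (truncate \<nu> n) d 0 (norm x)"
    "s' = moment (truncate \<nu> n) d 1 (norm x)" "q' = moment (truncate \<nu> n) d 2 (norm x)"
  have pos: "0 < m" "0 < m'" unfolding m_s_q_def m'_s'_q'_def by (rule moment_pos T.moment_pos)+
  have "m' * (s' / m')\<^sup>2 = s'\<^sup>2 / m'" using pos by (simp add: power2_eq_square)
  also have "\<dots> \<le> q" using T.moment_square_le[of "norm x"] moment_truncate_le[of n 2 "norm x"]
    by (simp add: m_s_q_def m'_s'_q'_def)
  finally have 1: "m' * (s' / m')\<^sup>2 \<le> q" .
  \<comment> \<open>The ratio s / m belongs to the full measure, so m' is enlarged to m before
    Cauchy-Schwarz is used.\<close>
  have "m' * (s / m)\<^sup>2 \<le> m * (s / m)\<^sup>2"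
    by (intro mult_right_mono) (auto simp: m_s_q_def m'_s'_q'_def moment_truncate_le)
  also have "\<dots> = s\<^sup>2 / m" using pos by (simp add: power2_eq_square)
  also have "\<dots> \<le> q" using moment_square_le by (simp add: m_s_q_def)
  finally have 2: "m' * (s / m)\<^sup>2 \<le> q" .
  have "(s' / m' - s / m)\<^sup>2 \<le> 2 * (s' / m')\<^sup>2 + 2 * (s / m)\<^sup>2"
    using zero_le_power2[of "s' / m' + s / m"] by (simp add: power2_diff power2_sum)
  then have "m' * (s' / m' - s / m)\<^sup>2 \<le> m' * (2 * (s' / m')\<^sup>2 + 2 * (s / m)\<^sup>2)"
    using pos by (intro mult_left_mono) auto
  also have "\<dots> \<le> 4 * q" using 1 2 by (simp add: distrib_left)
  finally have "m' * (s' / m' - s / m)\<^sup>2 * (norm x)\<^sup>2 \<le> 4 * q * (norm x)\<^sup>2"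
    by (intro mult_right_mono) auto
  moreover have "mixture_estimator \<nu> x - mixture_estimator (truncate \<nu> n) x = (s' / m' - s / m) *\<^sub>R x"
    unfolding mixture_estimator_eq[OF dim] T.mixture_estimator_eq[OF dim] m_s_q_def m'_s'_q'_def
    by (simp add: algebra_simps)
  ultimately show ?thesis
    by (simp add: m_s_q_def m'_s'_q'_def power_mult_distrib mult_ac)
qed

text \<open>Dominated convergence with the bound of \<open>truncation_gap_le\<close>, which
  \<open>fin\<close> makes integrable. The shift by \<open>N\<close> keeps every truncation
  nonzero.\<close>

lemma truncation_gap_tendsto_0:
  assumes dim: "d = CARD('n)" and N: "emeasure \<nu> {..real N} \<noteq> 0"
    and fin: "(\<integral>\<^sup>+g. ennreal (1 / (g + 1)) \<partial>\<nu>) < \<infinity>"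
  shows "(\<lambda>n. \<integral>\<^sup>+x. ennreal (moment (truncate \<nu> (N + n)) d 0 (norm x) *
      (norm (mixture_estimator \<nu> x - mixture_estimator (truncate \<nu> (N + n)) (x :: real ^ 'n)))\<^sup>2)
    \<partial>lborel) \<longlonglongrightarrow> 0"
proof -
  have nonnull: "emeasure \<nu> {..real (N + n)} \<noteq> 0" for n
  proof -
    have "emeasure \<nu> {..real N} \<le> emeasure \<nu> {..real (N + n)}"
      by (intro emeasure_mono) (auto simp: sets_mixing)
    then show ?thesis using N by auto
  qed
  interpret T: scale_mixture "truncate \<nu> (N + n)" d for n
    by (rule scale_mixture_truncate[OF nonnull])
  note [measurable] = borel_measurable_mixture_estimator[OF dim] T.borel_measurable_mixture_estimator[OF dim]
  have "(\<lambda>n. \<integral>\<^sup>+x. ennreal (moment (truncate \<nu> (N + n)) d 0 (norm x) *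
      (norm (mixture_estimator \<nu> x - mixture_estimator (truncate \<nu> (N + n)) (x :: real ^ 'n)))\<^sup>2)
    \<partial>lborel) \<longlonglongrightarrow> (\<integral>\<^sup>+x. 0 \<partial>(lborel :: (real ^ 'n) measure))"
  proof (rule nn_integral_dominated_convergence)
    show "(\<integral>\<^sup>+x. 4 * ennreal ((norm x)\<^sup>2 * moment \<nu> d 2 (norm (x :: real ^ 'n))) \<partial>lborel) < \<infinity>"
      using fin
      by (simp add: nn_integral_cmult nn_integral_square_moment[OF dim] ennreal_mult_less_top)
    show "AE x in lborel. ennreal (moment (truncate \<nu> (N + n)) d 0 (norm x) *
        (norm (mixture_estimator \<nu> x - mixture_estimator (truncate \<nu> (N + n)) (x :: real ^ 'n)))\<^sup>2)
        \<le> 4 * ennreal ((norm x)\<^sup>2 * moment \<nu> d 2 (norm x))" for n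
    proof (rule AE_I2)
      fix x :: "real ^ 'n"
      show "ennreal (moment (truncate \<nu> (N + n)) d 0 (norm x) *
        (norm (mixture_estimator \<nu> x - mixture_estimator (truncate \<nu> (N + n)) x))\<^sup>2)
        \<le> 4 * ennreal ((norm x)\<^sup>2 * moment \<nu> d 2 (norm x))"
        using ennreal_leI[OF truncation_gap_le[OF dim nonnull[of n], of x]]
        by (simp only: ennreal_mult'[of 4] ennreal_numeral zero_le_numeral)
    qed
    show "AE x in lborel. (\<lambda>n. ennreal (moment (truncate \<nu> (N + n)) d 0 (norm x) *
        (norm (mixture_estimator \<nu> x - mixture_estimator (truncate \<nu> (N + n)) (x :: real ^ 'n)))\<^sup>2))
        \<longlonglongrightarrow> 0"
    proof (rule AE_I2)
      fix x :: "real ^ 'n"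
      have lim: "(\<lambda>n. moment (truncate \<nu> (N + n)) d j (norm x)) \<longlonglongrightarrow> moment \<nu> d j (norm x)" for j
        using LIMSEQ_ignore_initial_segment[OF moment_truncate_tendsto[of j "norm x"], of N]
        by (simp add: add.commute)
      have "(\<lambda>n. mixture_estimator (truncate \<nu> (N + n)) x) \<longlonglongrightarrow> mixture_estimator \<nu> x"
        unfolding T.mixture_estimator_eq[OF dim] mixture_estimator_eq[OF dim]
        using moment_pos[of 0 "norm x"] by (intro tendsto_intros lim) auto
      then have "(\<lambda>n. moment (truncate \<nu> (N + n)) d 0 (norm x) *
          (norm (mixture_estimator \<nu> x - mixture_estimator (truncate \<nu> (N + n)) x))\<^sup>2) \<longlonglongrightarrow>
          moment \<nu> d 0 (norm x) * (norm (mixture_estimator \<nu> x - mixture_estimator \<nu> x))\<^sup>2"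
        by (intro tendsto_intros lim)
      from tendsto_ennrealI[OF this]
      show "(\<lambda>n. ennreal (moment (truncate \<nu> (N + n)) d 0 (norm x) *
          (norm (mixture_estimator \<nu> x - mixture_estimator (truncate \<nu> (N + n)) x))\<^sup>2)) \<longlonglongrightarrow> 0"
        by simp
    qed
  qed measurable
  then show ?thesis by simp
qed

text \<open>One fixed integral is bounded by every excess along the truncations, hence is 0;
  positivity of its weight then forces equality.\<close>

lemma dominating_estimator_AE_eq:
  fixes \<delta>' :: "real ^ 'n \<Rightarrow> real ^ 'n"
  assumes dim: "d = CARD('n)" and fin: "(\<integral>\<^sup>+g. ennreal (1 / (g + 1)) \<partial>\<nu>) < \<infinity>"
    and \<delta>'[measurable]: "\<delta>' \<in> borel_measurable borel"
    and le: "\<And>\<mu>. risk \<mu> \<delta>' \<le> risk \<mu> (mixture_estimator \<nu>)"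
  shows "AE x in lborel. \<delta>' x = mixture_estimator \<nu> x"
proof -
  note \<delta>[measurable] = borel_measurable_mixture_estimator[OF dim]
  obtain N where N: "emeasure \<nu> {..real N} \<noteq> 0" using exists_truncation_nonzero by blast
  interpret T\<^sub>N: scale_mixture "truncate \<nu> N" d by (rule scale_mixture_truncate[OF N])
  \<comment> \<open>The weight is frozen at level \<open>N\<close>, so that this quantity is
    independent of \<open>n\<close> in the limit.\<close>
  let ?Q = "\<integral>\<^sup>+x. ennreal (moment (truncate \<nu> N) d 0 (norm x) *
    (norm (mixture_estimator \<nu> x - \<delta>' x))\<^sup>2 / 4) \<partial>lborel"
  have "?Q \<le> (\<integral>\<^sup>+x. ennreal (moment (truncate \<nu> (N + n)) d 0 (norm x) *
      (norm (mixture_estimator \<nu> x - mixture_estimator (truncate \<nu> (N + n)) (x :: real ^ 'n)))\<^sup>2)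
      \<partial>lborel)" for n
  proof -
    have "emeasure \<nu> {..real N} \<le> emeasure \<nu> {..real (N + n)}"
      by (intro emeasure_mono) (auto simp: sets_mixing)
    then interpret T: scale_mixture "truncate \<nu> (N + n)" d
      using N by (intro scale_mixture_truncate) auto
    have "?Q \<le> (\<integral>\<^sup>+x. ennreal (moment (truncate \<nu> (N + n)) d 0 (norm x) *
        (norm (mixture_estimator \<nu> x - \<delta>' x))\<^sup>2 / 4) \<partial>lborel)"
      by (intro nn_integral_mono ennreal_leI divide_right_mono mult_right_mono moment_truncate_mono) auto
    also have "\<dots> \<le> (\<integral>\<^sup>+x. ennreal (moment (truncate \<nu> (N + n)) d 0 (norm x) *
      (norm (mixture_estimator \<nu> x - mixture_estimator (truncate \<nu> (N + n)) (x :: real ^ 'n)))\<^sup>2)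
      \<partial>lborel)"
      using finite_atMost[of "N + n"]
      by (intro T.dominating_estimator_distance_le dim \<delta> \<delta>' le) (simp only: emeasure_truncate)
    finally show ?thesis .
  qed
  then have "?Q \<le> 0"
    by (intro LIMSEQ_le_const[OF truncation_gap_tendsto_0[OF dim N fin]]) auto
  then have "AE x in lborel. ennreal (moment (truncate \<nu> N) d 0 (norm x) *
      (norm (mixture_estimator \<nu> x - \<delta>' x))\<^sup>2 / 4) = 0"
    by (subst (asm) le_zero_eq, subst (asm) nn_integral_0_iff_AE) auto
  then show ?thesis
  proof eventually_elim
    case (elim x)
    have "0 < moment (truncate \<nu> N) d 0 (norm x)" by (rule T\<^sub>N.moment_pos)
    with elim show ?case by (simp add: ennreal_eq_0_iff mult_le_0_iff)
  qed
qed

text \<open>Normal laws have Lebesgue densities, so estimators equal almost everywhere have equal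
  risk at every mean, which contradicts a strict improvement.\<close>

lemma admissible_mixture_estimator:
  assumes dim: "d = CARD('n)" and fin: "(\<integral>\<^sup>+g. ennreal (1 / (g + 1)) \<partial>\<nu>) < \<infinity>"
  shows "admissible (mixture_estimator \<nu> :: real ^ 'n \<Rightarrow> real ^ 'n)"
proof -
  note \<delta>[measurable] = borel_measurable_mixture_estimator[OF dim]
  have "\<not> inadmissible (mixture_estimator \<nu> :: real ^ 'n \<Rightarrow> real ^ 'n)"
  proof
    assume "inadmissible (mixture_estimator \<nu> :: real ^ 'n \<Rightarrow> real ^ 'n)"
    then obtain \<delta>' :: "real ^ 'n \<Rightarrow> real ^ 'n" and \<mu>\<^sub>0
      where [measurable]: "\<delta>' \<in> borel_measurable borel"
        and le: "\<And>\<mu>. risk \<mu> \<delta>' \<le> risk \<mu> (mixture_estimator \<nu>)"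
        and less: "risk \<mu>\<^sub>0 \<delta>' < risk \<mu>\<^sub>0 (mixture_estimator \<nu>)"
      unfolding inadmissible_def estimator_def by blast
    have "AE x in lborel. \<delta>' x = mixture_estimator \<nu> x"
      by (rule dominating_estimator_AE_eq[OF dim fin _ le]) measurable
    then have "risk \<mu>\<^sub>0 \<delta>' = risk \<mu>\<^sub>0 (mixture_estimator \<nu>)"
      unfolding risk_def normal_vec_def
      by (intro nn_integral_cong_AE, subst AE_density) (auto elim: eventually_mono)
    with less show False by simp
  qed
  then show ?thesis by (simp add: admissible_def estimator_def)
qed

end

theorem theorem3p1:
  fixes \<nu> :: "real measure"
  assumes "sets \<nu> = sets (restrict_space borel {0<..})"
    and "emeasure \<nu> {0<..} \<noteq> 0"
    and "(\<integral>\<^sup>+ g. ennreal ((g + 1) powr (- real CARD('n::finite) / 2)) \<partial>\<nu>) < \<infinity>"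
    and "(\<integral>\<^sup>+ g. ennreal (1 / (g + 1)) \<partial>\<nu>) < \<infinity>"
  shows "generalized_Bayes (mixture_prior \<nu>) (mixture_estimator \<nu> :: real ^ 'n \<Rightarrow> real ^ 'n)
    \<and> admissible (mixture_estimator \<nu> :: real ^ 'n \<Rightarrow> real ^ 'n)"
proof -
  have space: "space \<nu> = {0<..}"
    using sets_eq_imp_space_eq[OF assms(1)] by (simp add: space_restrict_space)
  have [measurable]: "(\<lambda>g. g) \<in> measurable \<nu> borel"
    by (subst measurable_cong_sets[OF assms(1) refl]) (simp add: measurable_restrict_space1)
  \<comment> \<open>The same measure with \<open>borel\<close> as its \<open>\<sigma>\<close>-algebra, so that Borel functions are measurable.\<close>
  define \<nu>' where "\<nu>' = distr \<nu> borel (\<lambda>g. g)"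
  interpret scale_mixture \<nu>' "CARD('n)"
  proof
    show "AE g in \<nu>'. 0 < g"
      unfolding \<nu>'_def by (subst AE_distr_iff) (auto simp: space)
    show "emeasure \<nu>' UNIV \<noteq> 0"
      using assms(2) by (simp add: \<nu>'_def emeasure_distr space)
    show "(\<integral>\<^sup>+ g. ennreal ((g + 1) powr (- real CARD('n) / 2)) \<partial>\<nu>') < \<infinity>"
      unfolding \<nu>'_def using assms(3) by (subst nn_integral_distr) auto
  qed (simp add: \<nu>'_def)
  \<comment> \<open>Prior and estimator depend on the mixing measure only through integrals, which
    the push-forward along the identity preserves.\<close>
  have "mixture_prior \<nu>' = (mixture_prior \<nu> :: real ^ 'n \<Rightarrow> ennreal)"
    unfolding mixture_prior_def \<nu>'_def by (subst nn_integral_distr) auto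
  moreover have "mixture_estimator \<nu>' = (mixture_estimator \<nu> :: real ^ 'n \<Rightarrow> real ^ 'n)"
    unfolding mixture_estimator_def \<nu>'_def by (subst (1 2) integral_distr) auto
  moreover have "(\<integral>\<^sup>+ g. ennreal (1 / (g + 1)) \<partial>\<nu>') < \<infinity>"
    unfolding \<nu>'_def using assms(4) by (subst nn_integral_distr) auto
  ultimately show ?thesis
    using generalized_Bayes_mixture_estimator[where 'n = 'n] admissible_mixture_estimator[where 'n = 'n]
    by simp
qed

end
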